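(* Let $G$ be a finite simple undirected graph that is claw-free and AT-free, with chromatic number $\chi(G)$. Then $\mathrm{cub}(G) \le \chi(G)$.
   Context: An asteroidal triple is an independent set of three vertices such that between each pair there is a path avoiding the neighbourhood of the third; $G$ is AT-free if it has none. $G$ is claw-free if it has no induced subgraph isomorphic to $K_{1,3}$. The cubicity $\mathrm{cub}(G)$ is the minimum integer $k$ such that $G$ is the intersection graph of a family of axis-parallel unit cubes in $\mathbb{R}^k$ (products $[a_1,a_1+1]\times\cdots\times[a_k,a_k+1]$), equivalently the minimum $k$ such that $G=I_1\cap\cdots\cap I_k$ for unit interval graphs $I_j$ on vertex set $V(G)$. *)

theory Defs
  imports
    Complex_Main
    "HOL-Library.FuncSet"
    "Graph_Theory.Graph_Theory"
begin

definition neighbourhood :: "('a, 'b) pre_digraph \<Rightarrow> 'a \<Rightarrow> 'a set" where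
  "neighbourhood G v = {u. v \<rightarrow>\<^bsub>G\<^esub> u}"

definition independent_set :: "('a, 'b) pre_digraph \<Rightarrow> 'a set \<Rightarrow> bool" where
  "independent_set G S \<longleftrightarrow> S \<subseteq> verts G \<and> (\<forall>u\<in>S. \<forall>v\<in>S. \<not> u \<rightarrow>\<^bsub>G\<^esub> v)"

definition path_avoiding :: "('a, 'b) pre_digraph \<Rightarrow> 'a \<Rightarrow> 'a \<Rightarrow> 'a set \<Rightarrow> bool" where
  "path_avoiding G u v S \<longleftrightarrow> (\<exists>p. vpath p G \<and> hd p = u \<and> last p = v \<and> set p \<inter> S = {})"

text \<open>
  The open neighbourhood of the third vertex is avoided. As the triple is independent, a path
  between two of its vertices that passes through the third one meets this neighbourhood, so the
  closed neighbourhood is then avoided as well.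
\<close>

definition asteroidal_triple :: "('a, 'b) pre_digraph \<Rightarrow> 'a \<Rightarrow> 'a \<Rightarrow> 'a \<Rightarrow> bool" where
  "asteroidal_triple G a b c \<longleftrightarrow>
     distinct [a, b, c] \<and> independent_set G {a, b, c} \<and>
     path_avoiding G a b (neighbourhood G c) \<and>
     path_avoiding G b c (neighbourhood G a) \<and>
     path_avoiding G a c (neighbourhood G b)"

definition AT_free :: "('a, 'b) pre_digraph \<Rightarrow> bool" where
  "AT_free G \<longleftrightarrow> \<not> (\<exists>a b c. asteroidal_triple G a b c)"

definition claw_free :: "('a, 'b) pre_digraph \<Rightarrow> bool" where
  "claw_free G \<longleftrightarrow> \<not> (\<exists>H. induced_subgraph H G \<and> K\<^bsub>1,3\<^esub> H)"

definition proper_colouring :: "('a, 'b) pre_digraph \<Rightarrow> nat \<Rightarrow> ('a \<Rightarrow> nat) \<Rightarrow> bool" where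
  "proper_colouring G k c \<longleftrightarrow>
     c ` verts G \<subseteq> {..<k} \<and> (\<forall>u\<in>verts G. \<forall>v\<in>verts G. u \<rightarrow>\<^bsub>G\<^esub> v \<longrightarrow> c u \<noteq> c v)"

definition chromatic_number :: "('a, 'b) pre_digraph \<Rightarrow> nat" where
  "chromatic_number G = (LEAST k. \<exists>c. proper_colouring G k c)"

text \<open>
  Points of \<open>\<real>\<^sup>k\<close> are the extensional functions from \<open>{..<k}\<close> to the reals. For \<open>k = 0\<close> there is
  exactly one point, so precisely the complete graphs have cubicity 0.
\<close>

definition unit_cube :: "nat \<Rightarrow> (nat \<Rightarrow> real) \<Rightarrow> (nat \<Rightarrow> real) set" where
  "unit_cube k a = (\<Pi>\<^sub>E i\<in>{..<k}. {a i .. a i + 1})"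

definition cube_representation ::
    "('a, 'b) pre_digraph \<Rightarrow> nat \<Rightarrow> ('a \<Rightarrow> nat \<Rightarrow> real) \<Rightarrow> bool" where
  "cube_representation G k f \<longleftrightarrow>
     (\<forall>u\<in>verts G. \<forall>v\<in>verts G. u \<noteq> v \<longrightarrow>
        (u \<rightarrow>\<^bsub>G\<^esub> v \<longleftrightarrow> unit_cube k (f u) \<inter> unit_cube k (f v) \<noteq> {}))"

definition cubicity :: "('a, 'b) pre_digraph \<Rightarrow> nat" where
  "cubicity G = (LEAST k. \<exists>f. cube_representation G k f)"

text \<open>Both minima are taken over nonempty sets when \<open>G\<close> is a finite simple graph.\<close>

lemma unit_cube_Int_nonempty_iff:
  "unit_cube k a \<inter> unit_cube k b \<noteq> {} \<longleftrightarrow> (\<forall>i<k. \<bar>a i - b i\<bar> \<le> 1)"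
proof -
  have "unit_cube k a \<inter> unit_cube k b = (\<Pi>\<^sub>E i\<in>{..<k}. {a i .. a i + 1} \<inter> {b i .. b i + 1})"
    unfolding unit_cube_def by (rule PiE_Int)
  moreover have "{a i .. a i + 1} \<inter> {b i .. b i + 1} \<noteq> {} \<longleftrightarrow> \<bar>a i - b i\<bar> \<le> 1" for i
    by (auto simp: Int_atLeastAtMost)
  ultimately show ?thesis
    by (simp add: PiE_eq_empty_iff Ball_def)
qed

lemma (in graph) proper_colouring_exists: "\<exists>k c. proper_colouring G k c"
proof -
  obtain c :: "'a \<Rightarrow> nat" and n where c: "c ` verts G = {i. i < n}" "inj_on c (verts G)"
    using finite_imp_inj_to_nat_seg[OF finite_verts] by blast
  have "proper_colouring G n c"
    unfolding proper_colouring_def using c adj_not_same by (auto simp: inj_on_eq_iff)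
  then show ?thesis by blast
qed

lemma (in graph) cube_representation_exists: "\<exists>k f. cube_representation G k f"
proof -
  obtain c :: "'a \<Rightarrow> nat" and n where c: "c ` verts G = {i. i < n}" "inj_on c (verts G)"
    using finite_imp_inj_to_nat_seg[OF finite_verts] by blast
  define f :: "'a \<Rightarrow> nat \<Rightarrow> real" where
    "f u i = (if c u = i then 0 else if \<exists>w\<in>verts G. c w = i \<and> w \<rightarrow>\<^bsub>G\<^esub> u then 1 else 3/2)" for u i
  have "u \<rightarrow>\<^bsub>G\<^esub> v \<longleftrightarrow> (\<forall>i<n. \<bar>f u i - f v i\<bar> \<le> 1)"
    if uv: "u \<in> verts G" "v \<in> verts G" "u \<noteq> v" for u v
  proof
    assume "u \<rightarrow>\<^bsub>G\<^esub> v"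
    moreover from this have "v \<rightarrow>\<^bsub>G\<^esub> u"
      using sym_arcs by (rule arcs_ends_symmetric[rotated])
    ultimately show "\<forall>i<n. \<bar>f u i - f v i\<bar> \<le> 1"
      using uv c(2) by (auto simp: f_def)
  next
    assume *: "\<forall>i<n. \<bar>f u i - f v i\<bar> \<le> 1"
    have "c u < n" using c(1) uv(1) by blast
    then have "\<bar>f u (c u) - f v (c u)\<bar> \<le> 1" using * by blast
    moreover have "c v \<noteq> c u" using uv c(2) by (auto simp: inj_on_eq_iff)
    ultimately have "\<exists>w\<in>verts G. c w = c u \<and> w \<rightarrow>\<^bsub>G\<^esub> v"
      by (auto simp: f_def split: if_splits)
    then show "u \<rightarrow>\<^bsub>G\<^esub> v" using uv c(2) by (auto simp: inj_on_eq_iff)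
  qed
  then have "cube_representation G n f"
    unfolding cube_representation_def by (simp add: unit_cube_Int_nonempty_iff)
  then show ?thesis by blast
qed

end

theory Submission
  imports Defs
begin

text \<open>
  Extend each colour class to a maximal independent set \<open>T\<close>. It suffices to find, for every such
  \<open>T\<close>, a unit interval supergraph of \<open>G\<close> that preserves all non-edges incident to \<open>T\<close>. Link two
  elements of \<open>T\<close> when some path between them sees no other element of \<open>T\<close>. Were three elements of
  \<open>T\<close> pairwise connected by links that do not use the third, they would form an asteroidal triple of
  \<open>G\<close>; hence the links form a disjoint union of paths, and \<open>T\<close> can be enumerated as
  \<open>s\<^sub>0, s\<^sub>1, \<dots>\<close> so that linked elements are consecutive. By claw-freeness every vertex outside \<open>T\<close>
  is then adjacent either to exactly one \<open>s\<^sub>i\<close> or to exactly \<open>s\<^sub>i\<close> and \<open>s\<^sub>i\<^sub>+\<^sub>1\<close>, and the positions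
  of the unit intervals can be written down explicitly.
\<close>

subsection \<open>Linear arrangements of relations\<close>

definition linear_arrangement :: "'a rel \<Rightarrow> 'a list \<Rightarrow> bool" where
  "linear_arrangement r xs \<longleftrightarrow> distinct xs \<and>
     (\<forall>i<length xs. \<forall>j<length xs. (xs ! i, xs ! j) \<in> r \<longrightarrow> j \<le> Suc i)"

definition separates :: "'a rel \<Rightarrow> 'a \<Rightarrow> 'a \<Rightarrow> 'a \<Rightarrow> bool" where
  "separates r c a b \<longleftrightarrow> (a, b) \<notin> rtrancl_on (- {c}) r"

definition linearly_separated :: "'a set \<Rightarrow> 'a rel \<Rightarrow> bool" where
  "linearly_separated S r \<longleftrightarrow> (\<forall>a\<in>S. \<forall>b\<in>S. \<forall>c\<in>S. distinct [a, b, c] \<longrightarrow>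
     separates r c a b \<or> separates r a b c \<or> separates r b a c)"

definition simple_path :: "'a rel \<Rightarrow> 'a set \<Rightarrow> 'a list \<Rightarrow> bool" where
  "simple_path r S xs \<longleftrightarrow> distinct xs \<and> set xs \<subseteq> S \<and> successively (\<lambda>x y. (x, y) \<in> r) xs"

lemma linear_arrangement_append:
  assumes "linear_arrangement r xs" "linear_arrangement r ys" "set xs \<inter> set ys = {}"
    and "\<And>x y. x \<in> set xs \<Longrightarrow> y \<in> set ys \<Longrightarrow> (x, y) \<notin> r"
  shows "linear_arrangement r (xs @ ys)"
  unfolding linear_arrangement_def
proof (intro conjI allI impI)
  fix i j assume ij: "i < length (xs @ ys)" "j < length (xs @ ys)" "((xs @ ys) ! i, (xs @ ys) ! j) \<in> r"
  consider (left) "i < length xs" "j < length xs" | (across) "i < length xs" "length xs \<le> j"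
    | (backward) "j < length xs" "length xs \<le> i" | (right) "length xs \<le> i" "length xs \<le> j"
    by linarith
  then show "j \<le> Suc i"
  proof cases
    case left
    then show ?thesis
      using ij assms(1) by (auto simp: linear_arrangement_def nth_append)
  next
    case across
    then have "(xs ! i, ys ! (j - length xs)) \<in> r" "j - length xs < length ys"
      using ij by (auto simp: nth_append)
    then show ?thesis
      using assms(4) across by simp
  next
    case right
    then have "(ys ! (i - length xs), ys ! (j - length xs)) \<in> r"
        "i - length xs < length ys" "j - length xs < length ys"
      using ij by (auto simp: nth_append)
    then have "j - length xs \<le> Suc (i - length xs)"
      using assms(2) unfolding linear_arrangement_def by blast
    then show ?thesis
      using right by linarith
  qed simp
qed (use assms in \<open>auto simp: linear_arrangement_def\<close>)

lemma successively_rtrancl_on: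
  assumes "successively (\<lambda>x y. (x, y) \<in> r) xs" and "i \<le> j" "j < length xs"
    and "(!) xs ` {i..j} \<subseteq> F"
  shows "(xs ! i, xs ! j) \<in> rtrancl_on F r"
  using assms(2-4)
proof (induction j rule: dec_induct)
  case (step n)
  have "(xs ! i, xs ! n) \<in> rtrancl_on F r"
    using step.prems by (intro step.IH) auto
  moreover have "(xs ! n, xs ! Suc n) \<in> r"
    using successively_nth[OF assms(1)] step.prems by simp
  moreover have "xs ! Suc n \<in> F"
    using step by auto
  ultimately show ?case
    by (rule rtrancl_on_into_rtrancl_on)
qed auto

lemma rtrancl_on_arcI:
  assumes "(a, b) \<in> r" "a \<in> F" "b \<in> F"
  shows "(a, b) \<in> rtrancl_on F r"
  using assms by (blast intro: rtrancl_on_into_rtrancl_on)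

lemma rtrancl_on_Int_Times: "rtrancl_on F (r \<inter> F \<times> F) = rtrancl_on F r"
proof (intro equalityI subrelI)
  fix a b assume "(a, b) \<in> rtrancl_on F r"
  then show "(a, b) \<in> rtrancl_on F (r \<inter> F \<times> F)"
  proof (induction rule: rtrancl_on_induct)
    case (step y z)
    then show ?case
      by (intro rtrancl_on_into_rtrancl_on[OF step.IH]) auto
  qed simp
qed (rule rtrancl_on_mono[OF Int_lower1 subset_refl])

lemma linear_arrangement_simple_path:
  assumes sep: "linearly_separated S r" and path: "simple_path r S xs"
  shows "linear_arrangement r xs"
  unfolding linear_arrangement_def
proof (intro conjI allI impI)
  show "distinct xs"
    using path by (simp add: simple_path_def)
  fix i j assume ij: "i < length xs" "j < length xs" "(xs ! i, xs ! j) \<in> r"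
  show "j \<le> Suc i"
  proof (rule ccontr)
    assume "\<not> j \<le> Suc i"
    then have less: "Suc i < j" by simp
    note neq = nth_eq_iff_index_eq[OF \<open>distinct xs\<close>]
    have succ: "successively (\<lambda>x y. (x, y) \<in> r) xs"
      using path by (simp add: simple_path_def)
    have "(!) xs ` {Suc i..j} \<subseteq> - {xs ! i}"
      using ij less by (auto simp: neq)
    then have "\<not> separates r (xs ! i) (xs ! Suc i) (xs ! j)"
      unfolding separates_def using successively_rtrancl_on[OF succ] ij(2) less by simp
    moreover have "\<not> separates r (xs ! j) (xs ! i) (xs ! Suc i)"
      unfolding separates_def using successively_nth[OF succ, of i] ij less
      by (auto simp: neq intro!: rtrancl_on_arcI)
    moreover have "\<not> separates r (xs ! Suc i) (xs ! i) (xs ! j)"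
      unfolding separates_def using ij less by (auto simp: neq intro!: rtrancl_on_arcI)
    moreover have "distinct [xs ! i, xs ! Suc i, xs ! j]" "set [xs ! i, xs ! Suc i, xs ! j] \<subseteq> S"
      using ij less path by (auto simp: neq simple_path_def)
    ultimately show False
      using sep unfolding linearly_separated_def by auto
  qed
qed

lemma linearly_separated_neighbours:
  assumes "linearly_separated S r" "sym r" "{a, b, c} \<subseteq> S" "x \<notin> {a, b, c}"
    and "(x, a) \<in> r" "(x, b) \<in> r" "(x, c) \<in> r"
  shows "\<not> distinct [a, b, c]"
proof
  assume distinct: "distinct [a, b, c]"
  have via_x: "\<not> separates r w u v"
    if "(x, u) \<in> r" "(x, v) \<in> r" "u \<noteq> w" "v \<noteq> w" "x \<noteq> w" for u v w
  proof -
    have "(u, x) \<in> rtrancl_on (- {w}) r" "(x, v) \<in> rtrancl_on (- {w}) r"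
      using that assms(2) by (auto intro!: rtrancl_on_arcI dest: symD)
    then show ?thesis
      unfolding separates_def by (blast intro: rtrancl_on_trans)
  qed
  have "separates r c a b \<or> separates r a b c \<or> separates r b a c"
    using assms(1,3) distinct by (simp add: linearly_separated_def)
  then show False
    using via_x assms(4-7) distinct by auto
qed

lemma longest_simple_path_exists:
  assumes "finite S"
  shows "\<exists>xs. is_arg_max length (simple_path r S) xs"
proof -
  have "length xs < Suc (card S)" if "simple_path r S xs" for xs
    using that assms by (metis simple_path_def card_mono distinct_card le_imp_less_Suc)
  moreover have "simple_path r S []"
    by (simp add: simple_path_def)
  ultimately show ?thesis
    unfolding is_arg_max_linorder by (intro ex_has_greatest_nat) auto
qed

lemma longest_simple_path_closed:
  assumes sep: "linearly_separated S r" and "sym r"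
    and longest: "is_arg_max length (simple_path r S) xs"
    and x: "x \<in> set xs" "(x, u) \<in> r" "u \<in> S"
  shows "u \<in> set xs"
proof (rule ccontr)
  assume u: "u \<notin> set xs"
  have path: "simple_path r S xs"
    using longest by (simp add: is_arg_max_linorder)
  have maximal: "\<not> simple_path r S zs" if "length xs < length zs" for zs
    using longest that by (auto simp: is_arg_max_linorder)
  obtain ys zs where xs: "xs = ys @ x # zs"
    using x(1) by (meson split_list)
  have "ys \<noteq> []"
    using maximal[of "u # xs"] path u x \<open>sym r\<close> xs by (auto simp: simple_path_def dest: symD)
  moreover have "zs \<noteq> []"
    using maximal[of "xs @ [u]"] path u x xs by (auto simp: simple_path_def successively_append_iff)
  ultimately have ends: "last ys \<in> set ys" "hd zs \<in> set zs"
    by simp_all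
  have "(last ys, x) \<in> r" "(x, hd zs) \<in> r"
    using path \<open>ys \<noteq> []\<close> \<open>zs \<noteq> []\<close> xs
    by (auto simp: simple_path_def successively_append_iff successively_Cons)
  moreover have "distinct [last ys, hd zs, u]" "x \<notin> {last ys, hd zs, u}" "{last ys, hd zs, u} \<subseteq> S"
    using path u x ends xs by (auto simp: simple_path_def)
  ultimately show False
    using linearly_separated_neighbours[OF sep \<open>sym r\<close>] x(2) \<open>sym r\<close> by (metis symD)
qed

theorem linear_arrangement_exists:
  assumes "finite S" "sym r" "linearly_separated S r"
  shows "\<exists>xs. set xs = S \<and> linear_arrangement r xs"
  using assms(1,3)
proof (induction S rule: finite_psubset_induct)
  case (psubset S)
  obtain xs where longest: "is_arg_max length (simple_path r S) xs"
    using longest_simple_path_exists psubset.hyps by blast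
  then have path: "simple_path r S xs"
    by (simp add: is_arg_max_linorder)
  show ?case
  proof (cases "xs = []")
    case True
    have "\<not> simple_path r S [z]" for z
      using longest True by (auto simp: is_arg_max_linorder)
    then have "S = {}"
      by (auto simp: simple_path_def)
    then show ?thesis
      by (simp add: linear_arrangement_def)
  next
    case False
    then have "S - set xs \<subset> S"
      using path by (cases xs) (auto simp: simple_path_def)
    moreover have "linearly_separated (S - set xs) r"
      using psubset.prems by (auto simp: linearly_separated_def)
    ultimately obtain ys where ys: "set ys = S - set xs" "linear_arrangement r ys"
      using psubset.IH by blast
    have "linear_arrangement r (xs @ ys)"
      using longest_simple_path_closed[OF psubset.prems \<open>sym r\<close> longest] ys
      by (intro linear_arrangement_append linear_arrangement_simple_path[OF psubset.prems path]) auto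
    moreover have "set (xs @ ys) = S"
      using path ys by (auto simp: simple_path_def)
    ultimately show ?thesis
      by blast
  qed
qed

subsection \<open>Links in an independent set\<close>

definition closed_neighbourhood :: "('a, 'b) pre_digraph \<Rightarrow> 'a \<Rightarrow> 'a set" where
  "closed_neighbourhood G v = insert v (neighbourhood G v)"

definition dominating_set :: "('a, 'b) pre_digraph \<Rightarrow> 'a set \<Rightarrow> bool" where
  "dominating_set G T \<longleftrightarrow> T \<subseteq> verts G \<and> (\<forall>v\<in>verts G. \<exists>t\<in>T. v \<in> closed_neighbourhood G t)"

definition links :: "('a, 'b) pre_digraph \<Rightarrow> 'a set \<Rightarrow> 'a rel" where
  "links G T = {(s, t). s \<in> T \<and> t \<in> T \<and> path_avoiding G s t (\<Union>x\<in>T - {s, t}. neighbourhood G x)}"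

lemma (in sym_digraph) adj_sym: "u \<rightarrow>\<^bsub>G\<^esub> v \<Longrightarrow> v \<rightarrow>\<^bsub>G\<^esub> u"
  by (rule arcs_ends_symmetric[OF sym_arcs])

lemma arcs_ends_induce_subgraph: "arcs_ends (G \<restriction> X) = arcs_ends G \<inter> X \<times> X"
  by (auto simp: arcs_ends_conv)

lemma vpath_induce_subgraph_iff:
  assumes "X \<subseteq> verts G"
  shows "vpath p (G \<restriction> X) \<longleftrightarrow> vpath p G \<and> set p \<subseteq> X"
proof -
  have "set (vwalk_arcs p) \<subseteq> set p \<times> set p"
    by (auto elim: in_set_vwalk_arcsE)
  then show ?thesis
    using assms unfolding vpath_def vwalk_def arcs_ends_induce_subgraph by auto
qed

lemma (in wf_digraph) path_avoiding_iff_rtrancl_on: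
  "path_avoiding G u v S \<longleftrightarrow> (u, v) \<in> rtrancl_on (verts G - S) (arcs_ends G)"
proof -
  let ?H = "G \<restriction> (verts G - S)"
  interpret H: wf_digraph ?H
    by (rule wellformed_induce_subgraph)
  have "vpath p G \<Longrightarrow> set p \<subseteq> verts G" for p
    by (simp add: vpath_def vwalk_def)
  then have "path_avoiding G u v S \<longleftrightarrow> (\<exists>p. vpath p ?H \<and> hd p = u \<and> last p = v)"
    unfolding path_avoiding_def vpath_induce_subgraph_iff[OF Diff_subset] by blast
  also have "\<dots> \<longleftrightarrow> u \<rightarrow>\<^sup>*\<^bsub>?H\<^esub> v"
    by (rule H.reachable_vpath_conv[symmetric])
  finally show ?thesis
    by (simp add: reachable_def arcs_ends_induce_subgraph rtrancl_on_Int_Times)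
qed

lemma (in sym_digraph) sym_links: "sym (links G T)"
proof (rule symI)
  fix s t assume st: "(s, t) \<in> links G T"
  have "path_avoiding G t s (\<Union>x\<in>T - {s, t}. neighbourhood G x)"
    using st symD[OF rtrancl_on_sym[OF sym_arcs[unfolded symmetric_def]]]
    by (auto simp: links_def path_avoiding_iff_rtrancl_on)
  then show "(t, s) \<in> links G T"
    using st by (auto simp: links_def insert_commute)
qed

lemma (in wf_digraph) linksI:
  assumes T: "independent_set G T" "s \<in> T" "t \<in> T"
    and walk: "s = u \<or> s \<rightarrow>\<^bsub>G\<^esub> u" "u = v \<or> u \<rightarrow>\<^bsub>G\<^esub> v" "v = t \<or> v \<rightarrow>\<^bsub>G\<^esub> t"
    and unseen: "\<And>x. x \<in> T \<Longrightarrow> x \<rightarrow>\<^bsub>G\<^esub> u \<or> x \<rightarrow>\<^bsub>G\<^esub> v \<Longrightarrow> x = s \<or> x = t"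
  shows "(s, t) \<in> links G T"
proof -
  define F where "F = verts G - (\<Union>x\<in>T - {s, t}. neighbourhood G x)"
  have st: "s \<in> F" "t \<in> F"
    using T by (auto simp: F_def independent_set_def neighbourhood_def)
  then have "u \<in> verts G" "v \<in> verts G"
    using walk adj_in_verts by (auto simp: F_def)
  then have uv: "u \<in> F" "v \<in> F"
    using unseen by (auto simp: F_def neighbourhood_def)
  have "(s, u) \<in> rtrancl_on F (arcs_ends G)"
    using walk(1) st uv by (auto intro: rtrancl_on_arcI)
  also have "(u, v) \<in> rtrancl_on F (arcs_ends G)"
    using walk(2) uv by (auto intro: rtrancl_on_arcI)
  also (rtrancl_on_trans) have "(v, t) \<in> rtrancl_on F (arcs_ends G)"
    using walk(3) st uv by (auto intro: rtrancl_on_arcI)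
  finally (rtrancl_on_trans) show ?thesis
    using T by (simp add: links_def path_avoiding_iff_rtrancl_on F_def)
qed

lemma (in wf_digraph) path_avoiding_if_not_separates_links:
  assumes "independent_set G T" "a \<in> T" "c \<in> T"
    and "\<not> separates (links G T) c a b"
  shows "path_avoiding G a b (neighbourhood G c)"
proof -
  have "(a, b) \<in> rtrancl_on (- {c}) (links G T)"
    using assms(4) by (simp add: separates_def)
  then show ?thesis
  proof (induction rule: rtrancl_on_induct)
    case base
    then show ?case
      using assms(1-3)
      by (auto simp: path_avoiding_iff_rtrancl_on independent_set_def neighbourhood_def)
  next
    case (step y z)
    let ?N = "\<Union>x\<in>T - {y, z}. neighbourhood G x"
    have "neighbourhood G c \<subseteq> ?N"
      using step.hyps assms(3) by auto
    then have avoiding: "verts G - ?N \<subseteq> verts G - neighbourhood G c"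
      by (rule Diff_mono[OF subset_refl])
    have "path_avoiding G y z ?N"
      using step.hyps(2) by (simp add: links_def)
    then have "path_avoiding G y z (neighbourhood G c)"
      unfolding path_avoiding_iff_rtrancl_on by (rule rtrancl_on_mono[OF subset_refl avoiding])
    with step.IH show ?case
      unfolding path_avoiding_iff_rtrancl_on by (rule rtrancl_on_trans)
  qed
qed

lemma (in wf_digraph) linearly_separated_links:
  assumes AT: "AT_free G" and T: "independent_set G T"
  shows "linearly_separated T (links G T)"
  unfolding linearly_separated_def
proof (intro ballI impI, rule ccontr)
  let ?sep = "separates (links G T)"
  fix a b c
  assume abc: "a \<in> T" "b \<in> T" "c \<in> T" "distinct [a, b, c]"
    and "\<not> (?sep c a b \<or> ?sep a b c \<or> ?sep b a c)"
  moreover have "independent_set G {a, b, c}"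
    using T abc by (auto simp: independent_set_def)
  ultimately have "asteroidal_triple G a b c"
    unfolding asteroidal_triple_def using path_avoiding_if_not_separates_links[OF T] by blast
  then show False
    using AT unfolding AT_free_def by blast
qed

lemma (in graph) claw_freeD:
  assumes cf: "claw_free G" and adj: "c \<rightarrow>\<^bsub>G\<^esub> x" "c \<rightarrow>\<^bsub>G\<^esub> y" "c \<rightarrow>\<^bsub>G\<^esub> z" and "distinct [x, y, z]"
  shows "x \<rightarrow>\<^bsub>G\<^esub> y \<or> x \<rightarrow>\<^bsub>G\<^esub> z \<or> y \<rightarrow>\<^bsub>G\<^esub> z"
proof (rule ccontr)
  assume indep: "\<not> ?thesis"
  let ?H = "G \<restriction> {c, x, y, z}"
  have "{c, x, y, z} \<subseteq> verts G"
    using adj adj_in_verts by auto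
  then have ind: "induced_subgraph ?H G"
    by (rule induced_induce)
  then have "graph ?H"
    using digraphI_induced induced_graph_imp_graph
    by (simp add: graph_def pseudo_graph_def digraph_def)
  have ne: "c \<noteq> x" "c \<noteq> y" "c \<noteq> z" and irr: "\<not> u \<rightarrow>\<^bsub>G\<^esub> u" for u
    using adj adj_not_same by blast+
  have ends: "arcs_ends ?H = {c} \<times> {x, y, z} \<union> {x, y, z} \<times> {c}"
    unfolding arcs_ends_induce_subgraph using indep adj adj_sym irr by auto
  have "verts ?H = {c} \<union> {x, y, z}" "{c} \<inter> {x, y, z} = {}" "card {c} = 1" "card {x, y, z} = 3"
    using ne assms(5) by auto
  with ends \<open>graph ?H\<close> have "K\<^bsub>1,3\<^esub> ?H"
    unfolding complete_bipartite_digraph_def by metis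
  with ind cf show False
    unfolding claw_free_def by blast
qed

lemma (in graph) independent_dominating_superset_exists:
  assumes "independent_set G S"
  shows "\<exists>T. S \<subseteq> T \<and> independent_set G T \<and> dominating_set G T"
proof -
  have "{T. independent_set G T} \<subseteq> Pow (verts G)"
    by (auto simp: independent_set_def)
  then have "finite {T. independent_set G T}"
    by (rule finite_subset) simp
  then obtain T where T: "S \<subseteq> T" "independent_set G T"
    and maximal: "\<And>U. independent_set G U \<Longrightarrow> T \<subseteq> U \<Longrightarrow> T = U"
    using finite_has_maximal2[of "{T. independent_set G T}" S] assms by auto
  have "\<exists>t\<in>T. v \<in> closed_neighbourhood G t" if v: "v \<in> verts G" for v
  proof (rule ccontr)
    assume none: "\<not> ?thesis"
    then have "independent_set G (insert v T)"
      using T(2) v adj_sym adj_not_same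
      unfolding independent_set_def closed_neighbourhood_def neighbourhood_def by blast
    then show False
      using maximal none by (auto simp: closed_neighbourhood_def)
  qed
  then show ?thesis
    using T by (auto simp: dominating_set_def independent_set_def)
qed

subsection \<open>The unit interval supergraph\<close>

definition separating_unit_interval_map :: "('a, 'b) pre_digraph \<Rightarrow> 'a set \<Rightarrow> ('a \<Rightarrow> real) \<Rightarrow> bool" where
  "separating_unit_interval_map G S f \<longleftrightarrow>
     (\<forall>u v. u \<rightarrow>\<^bsub>G\<^esub> v \<longrightarrow> \<bar>f u - f v\<bar> \<le> 1) \<and>
     (\<forall>s\<in>S. \<forall>v\<in>verts G. s \<noteq> v \<longrightarrow> \<not> s \<rightarrow>\<^bsub>G\<^esub> v \<longrightarrow> \<bar>f s - f v\<bar> > 1)"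

lemma separating_unit_interval_map_subset:
  assumes "separating_unit_interval_map G T f" "S \<subseteq> T"
  shows "separating_unit_interval_map G S f"
  using assms unfolding separating_unit_interval_map_def by blast

locale arranged_dominating_set = graph +
  fixes ss :: "'a list"
  assumes claw_free: "claw_free G"
    and independent: "independent_set G (set ss)"
    and dominating: "dominating_set G (set ss)"
    and arranged: "linear_arrangement (links G (set ss)) ss"
begin

definition seen :: "'a \<Rightarrow> nat set" where
  "seen v = {i. i < length ss \<and> v \<in> closed_neighbourhood G (ss ! i)}"

definition first :: "'a \<Rightarrow> nat" where
  "first v = Min (seen v)"

definition wide :: "'a \<Rightarrow> bool" where
  "wide v \<longleftrightarrow> Suc (first v) \<in> seen v"

lemma finite_seen: "finite (seen v)"
  by (simp add: seen_def)

lemma seen_less: "i \<in> seen v \<Longrightarrow> i < length ss"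
  by (simp add: seen_def)

lemma first_le: "i \<in> seen v \<Longrightarrow> first v \<le> i"
  by (simp add: first_def finite_seen)

lemma first_in_seen:
  assumes "v \<in> verts G"
  shows "first v \<in> seen v"
proof -
  obtain t where "t \<in> set ss" "v \<in> closed_neighbourhood G t"
    using dominating assms by (auto simp: dominating_set_def)
  then have "seen v \<noteq> {}"
    by (auto simp: seen_def in_set_conv_nth)
  then show ?thesis
    by (simp add: first_def finite_seen)
qed

lemma nonadjacent_nth: "i < length ss \<Longrightarrow> j < length ss \<Longrightarrow> \<not> ss ! i \<rightarrow>\<^bsub>G\<^esub> ss ! j"
  using independent by (auto simp: independent_set_def)

lemma nth_eq_iff: "i < length ss \<Longrightarrow> j < length ss \<Longrightarrow> ss ! i = ss ! j \<longleftrightarrow> i = j"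
  using arranged by (simp add: linear_arrangement_def nth_eq_iff_index_eq)

lemma seen_nth: "i < length ss \<Longrightarrow> seen (ss ! i) = {i}"
  by (auto simp: seen_def closed_neighbourhood_def neighbourhood_def nonadjacent_nth nth_eq_iff)

lemma seen_cases:
  assumes "i \<in> seen v"
  obtains (member) "v = ss ! i" "seen v = {i}" | (adjacent) "ss ! i \<rightarrow>\<^bsub>G\<^esub> v" "v \<rightarrow>\<^bsub>G\<^esub> ss ! i"
proof (cases "v = ss ! i")
  case True
  then show ?thesis
    using that(1) assms seen_nth seen_less by blast
next
  case False
  then have "ss ! i \<rightarrow>\<^bsub>G\<^esub> v"
    using assms by (simp add: seen_def closed_neighbourhood_def neighbourhood_def)
  then show ?thesis
    using that(2) adj_sym by blast
qed

lemma adj_imp_seen: "i < length ss \<Longrightarrow> ss ! i \<rightarrow>\<^bsub>G\<^esub> v \<Longrightarrow> i \<in> seen v"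
  by (simp add: seen_def closed_neighbourhood_def neighbourhood_def)

lemma le_Suc_if_no_other_seen:
  assumes i: "i \<in> seen u" and j: "j \<in> seen v" and uv: "u = v \<or> u \<rightarrow>\<^bsub>G\<^esub> v"
    and no_other: "seen u \<union> seen v \<subseteq> {i, j}"
  shows "j \<le> Suc i"
proof -
  have "(ss ! i, ss ! j) \<in> links G (set ss)"
  proof (rule linksI[OF independent])
    show "ss ! i = u \<or> ss ! i \<rightarrow>\<^bsub>G\<^esub> u" "v = ss ! j \<or> v \<rightarrow>\<^bsub>G\<^esub> ss ! j"
      using i j by (auto elim: seen_cases)
    show "x = ss ! i \<or> x = ss ! j" if "x \<in> set ss" "x \<rightarrow>\<^bsub>G\<^esub> u \<or> x \<rightarrow>\<^bsub>G\<^esub> v" for x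
    proof -
      obtain k where k: "k < length ss" "x = ss ! k"
        using \<open>x \<in> set ss\<close> by (auto simp: in_set_conv_nth)
      then have "k \<in> seen u \<union> seen v"
        using that(2) adj_imp_seen by blast
      then show ?thesis
        using no_other k(2) by blast
    qed
  qed (use i j uv seen_less in auto)
  then show ?thesis
    using arranged i j seen_less by (simp add: linear_arrangement_def)
qed

lemma seen_subset_pair:
  assumes "i \<in> seen v" "j \<in> seen v" "i \<noteq> j"
  shows "seen v \<subseteq> {i, j}"
proof
  fix k assume k: "k \<in> seen v"
  have adj: "v \<rightarrow>\<^bsub>G\<^esub> ss ! l" if "l \<in> seen v" for l
    using that assms by (cases rule: seen_cases) auto
  show "k \<in> {i, j}"
  proof (rule ccontr)
    assume "k \<notin> {i, j}"
    note less = assms(1,2)[THEN seen_less] k[THEN seen_less]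
    have "distinct [ss ! i, ss ! j, ss ! k]"
      using \<open>k \<notin> {i, j}\<close> assms(3) less by (auto simp: nth_eq_iff)
    then show False
      using claw_freeD[OF claw_free assms(1,2)[THEN adj] k[THEN adj]] less
      by (simp add: nonadjacent_nth)
  qed
qed

lemma seen_le_Suc:
  assumes "i \<in> seen v" "j \<in> seen v"
  shows "j \<le> Suc i"
proof (cases "i = j")
  case False
  then show ?thesis
    using le_Suc_if_no_other_seen[OF assms] seen_subset_pair[OF assms] by simp
qed simp

lemma seen_eq:
  assumes "v \<in> verts G"
  shows "seen v = (if wide v then {first v, Suc (first v)} else {first v})"
proof -
  have "i = first v \<or> i = Suc (first v)" if "i \<in> seen v" for i
    using seen_le_Suc[OF first_in_seen[OF assms] that] first_le[OF that] by linarith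
  then show ?thesis
    using first_in_seen[OF assms] by (auto simp: wide_def)
qed

lemma wide_adjacent_share:
  assumes uv: "u \<rightarrow>\<^bsub>G\<^esub> v" and "wide u"
  shows "seen u \<inter> seen v \<noteq> {}"
proof -
  let ?s = "ss ! first u" and ?t = "ss ! Suc (first u)"
  have seen: "first u \<in> seen u" "Suc (first u) \<in> seen u"
    using uv \<open>wide u\<close> first_in_seen adj_in_verts by (auto simp: wide_def)
  have adj: "u \<rightarrow>\<^bsub>G\<^esub> ?s" "u \<rightarrow>\<^bsub>G\<^esub> ?t"
    using seen by (auto elim: seen_cases)
  have "v = ?s \<or> v = ?t \<or> ?s \<rightarrow>\<^bsub>G\<^esub> v \<or> ?t \<rightarrow>\<^bsub>G\<^esub> v"
    using claw_freeD[OF claw_free adj uv] nonadjacent_nth nth_eq_iff seen_less seen by auto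
  then have "first u \<in> seen v \<or> Suc (first u) \<in> seen v"
    using seen seen_less seen_nth adj_imp_seen by auto
  then show ?thesis
    using seen by blast
qed

lemma first_adjacent_le_Suc:
  assumes uv: "u \<rightarrow>\<^bsub>G\<^esub> v"
  shows "first v \<le> Suc (first u)"
proof -
  note verts = adj_in_verts[OF uv]
  show ?thesis
  proof (cases "wide u \<or> wide v")
    case True
    then obtain i where "i \<in> seen u" "i \<in> seen v"
      using wide_adjacent_share[OF uv] wide_adjacent_share[OF adj_sym[OF uv]] by blast
    then show ?thesis
      using seen_le_Suc[OF first_in_seen[OF verts(1)]] first_le by (meson le_trans)
  next
    case False
    then show ?thesis
      using uv seen_eq verts by (intro le_Suc_if_no_other_seen[of _ u _ v]) auto
  qed
qed

lemma wide_if_adjacent_wide_Suc: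
  assumes uv: "u \<rightarrow>\<^bsub>G\<^esub> v" and "wide v" "first v = Suc (first u)"
  shows "wide u"
proof -
  obtain i where "i \<in> seen u" "i \<in> seen v"
    using wide_adjacent_share[OF adj_sym[OF uv] \<open>wide v\<close>] by blast
  then show ?thesis
    using seen_le_Suc[OF first_in_seen[OF adj_in_verts(1)[OF uv]]] first_le assms(3)
    by (metis wide_def le_antisym)
qed

lemma narrow_Suc_notin_independent:
  assumes uv: "u \<rightarrow>\<^bsub>G\<^esub> v" and "\<not> wide u" "\<not> wide v" "first v = Suc (first u)"
  shows "u \<notin> set ss" "v \<notin> set ss"
proof -
  note verts = adj_in_verts[OF uv]
  have disjoint: "seen u \<inter> seen v = {}"
    using seen_eq[OF verts(1)] seen_eq[OF verts(2)] assms by auto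
  show "u \<notin> set ss"
    using disjoint seen_nth adj_imp_seen uv by (fastforce simp: in_set_conv_nth)
  show "v \<notin> set ss"
    using disjoint seen_nth adj_imp_seen adj_sym[OF uv] by (fastforce simp: in_set_conv_nth)
qed

lemma no_narrow_ascent:
  assumes uv: "u \<rightarrow>\<^bsub>G\<^esub> v" "first v = Suc (first u)" and vw: "v \<rightarrow>\<^bsub>G\<^esub> w" "first w = Suc (first v)"
    and narrow: "\<not> wide u" "\<not> wide v" "\<not> wide w"
  shows False
proof -
  let ?s = "ss ! first v"
  note verts = adj_in_verts[OF uv(1)] adj_in_verts[OF vw(1)]
  have v: "first v \<in> seen v"
    using verts by (simp add: first_in_seen)
  have unseen: "first v \<notin> seen u" "first v \<notin> seen w"
    using seen_eq verts narrow uv vw by auto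
  have "v \<rightarrow>\<^bsub>G\<^esub> ?s"
    using v
  proof (cases rule: seen_cases)
    case member
    then show ?thesis
      using narrow_Suc_notin_independent(2)[OF uv(1) narrow(1,2) uv(2)] nth_mem[OF seen_less[OF v]]
      by metis
  qed
  moreover have "\<not> ?s \<rightarrow>\<^bsub>G\<^esub> u" "\<not> ?s \<rightarrow>\<^bsub>G\<^esub> w" "?s \<noteq> u" "?s \<noteq> w"
    using unseen v seen_less seen_nth adj_imp_seen by auto
  moreover have "\<not> u \<rightarrow>\<^bsub>G\<^esub> w" "u \<noteq> w"
    using first_adjacent_le_Suc[of u w] uv vw by auto
  ultimately show False
    using claw_freeD[OF claw_free, of v ?s u w] adj_sym[OF uv(1)] vw(1) by auto
qed

definition raised :: "'a \<Rightarrow> bool" where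
  "raised v \<longleftrightarrow> (\<exists>w. v \<rightarrow>\<^bsub>G\<^esub> w \<and> \<not> wide w \<and> first w = Suc (first v))"

definition gap :: real where
  "gap = 1 / (length ss + 1)"

text \<open>
  The spacing of \<open>ss\<close> is \<open>1 + gap\<close>, so vertices that are not wide only have to stay strictly
  within \<open>gap\<close> of the element that they see; raising some of them brings adjacent ones that see
  consecutive elements to distance exactly 1. Wide vertices drift to the left relative to the first
  element that they see as its index grows, which puts consecutive classes of them at distance
  exactly 1.
\<close>

definition pos :: "'a \<Rightarrow> real" where
  "pos v = (if wide v then first v + 1 - gap / 2
     else first v + gap * first v + (if v \<in> set ss then 0 else if raised v then gap / 2 else - gap / 2))"

lemma gap_gt_0: "0 < gap"
  by (simp add: gap_def)

lemma pos_bounds: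
  assumes "v \<in> verts G"
  shows "first v + gap * first v - gap / 2 \<le> pos v" and "pos v \<le> first v + 1 - gap / 2"
proof -
  have "gap * real (first v + 1) \<le> 1"
    using seen_less[OF first_in_seen[OF assms]] by (simp add: gap_def field_simps)
  then show "first v + gap * first v - gap / 2 \<le> pos v" "pos v \<le> first v + 1 - gap / 2"
    using gap_gt_0 by (auto simp: pos_def algebra_simps)
qed

lemma pos_narrow_upper: "\<not> wide v \<Longrightarrow> pos v \<le> first v + gap * first v + gap / 2"
  using gap_gt_0 by (simp add: pos_def)

lemma pos_nth:
  assumes "i < length ss"
  shows "pos (ss ! i) = i + gap * i"
  using assms by (simp add: pos_def wide_def first_def seen_nth)

lemma pos_adjacent_le:
  assumes uv: "u \<rightarrow>\<^bsub>G\<^esub> v" and "first u \<le> first v"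
  shows "\<bar>pos u - pos v\<bar> \<le> 1"
proof -
  note bounds = pos_bounds[OF adj_in_verts(1)[OF uv]] pos_bounds[OF adj_in_verts(2)[OF uv]]
  have drift: "0 \<le> gap * first u" "0 \<le> gap * first v"
    using gap_gt_0 by simp_all
  consider (same) "first v = first u" | (wide) "first v = Suc (first u)" "wide u"
    | (narrow) "first v = Suc (first u)" "\<not> wide u" "\<not> wide v"
    using first_adjacent_le_Suc[OF uv] assms(2) wide_if_adjacent_wide_Suc[OF uv] le_SucE le_antisym
    by metis
  then show ?thesis
  proof cases
    case same
    then show ?thesis
      using bounds drift by simp
  next
    case wide
    then have "pos u = first u + 1 - gap / 2" "real (first v) = first u + 1"
      by (simp_all add: pos_def)
    then show ?thesis
      using bounds(3,4) drift(2) gap_gt_0 by linarith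
  next
    case narrow
    have "raised u"
      using narrow uv by (auto simp: raised_def)
    moreover have "\<not> raised v"
      using no_narrow_ascent[OF uv] narrow by (auto simp: raised_def)
    ultimately show ?thesis
      using narrow narrow_Suc_notin_independent[OF uv] by (simp add: pos_def algebra_simps)
  qed
qed

lemma pos_unseen_gt:
  assumes i: "i < length ss" "i \<notin> seen v" and v: "v \<in> verts G"
  shows "\<bar>pos (ss ! i) - pos v\<bar> > 1"
proof -
  note bounds = pos_bounds[OF v] gap_gt_0
  have gap_mono: "gap * m + gap * k \<le> gap * n" if "m + k \<le> n" for m k n :: nat
    using gap_gt_0 that by (simp flip: distrib_left of_nat_add)
  have drift: "0 \<le> gap * i"
    using gap_gt_0 by simp
  consider (before) "i + 1 \<le> first v" | (after_narrow) "first v + 1 \<le> i" "\<not> wide v"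
    | (after_wide) "first v + 2 \<le> i" "wide v"
    using i(2) seen_eq[OF v] by (cases "wide v") fastforce+
  then show ?thesis
  proof cases
    case before
    then have "real i + 1 \<le> first v"
      by simp
    then show ?thesis
      using gap_mono[OF before] bounds pos_nth[OF i(1)] by simp
  next
    case after_narrow
    then have "real (first v) + 1 \<le> i"
      by simp
    then show ?thesis
      using gap_mono[OF after_narrow(1)] pos_narrow_upper[OF after_narrow(2)] gap_gt_0 pos_nth[OF i(1)]
      by simp
  next
    case after_wide
    then have "real (first v) + 2 \<le> i"
      by simp
    then show ?thesis
      using bounds drift pos_nth[OF i(1)] by linarith
  qed
qed

theorem separating_unit_interval_map_pos: "separating_unit_interval_map G (set ss) pos"
  unfolding separating_unit_interval_map_def
proof (intro conjI allI ballI impI)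
  fix u v assume uv: "u \<rightarrow>\<^bsub>G\<^esub> v"
  show "\<bar>pos u - pos v\<bar> \<le> 1"
    using pos_adjacent_le[OF uv] pos_adjacent_le[OF adj_sym[OF uv]]
    by (cases "first u \<le> first v") (auto simp: abs_minus_commute)
next
  fix s v assume s: "s \<in> set ss" "v \<in> verts G" "s \<noteq> v" "\<not> s \<rightarrow>\<^bsub>G\<^esub> v"
  then obtain i where "i < length ss" "s = ss ! i"
    by (auto simp: in_set_conv_nth)
  moreover from this have "i \<notin> seen v"
    using s by (auto elim: seen_cases)
  ultimately show "\<bar>pos s - pos v\<bar> > 1"
    using pos_unseen_gt s(2) by simp
qed

end

theorem (in graph) separating_unit_interval_map_exists:
  assumes "claw_free G" "AT_free G" "independent_set G S"
  shows "\<exists>f. separating_unit_interval_map G S f"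
proof -
  obtain T where T: "S \<subseteq> T" "independent_set G T" "dominating_set G T"
    using independent_dominating_superset_exists[OF assms(3)] by blast
  have "finite T"
    using T(2) finite_verts by (auto simp: independent_set_def intro: finite_subset)
  then obtain ss where "set ss = T" "linear_arrangement (links G T) ss"
    using linear_arrangement_exists sym_links linearly_separated_links[OF assms(2) T(2)] by blast
  with T assms(1) interpret arranged_dominating_set G ss
    by unfold_locales auto
  have "separating_unit_interval_map G S pos"
    using separating_unit_interval_map_pos T(1) \<open>set ss = T\<close>
    by (blast intro: separating_unit_interval_map_subset)
  then show ?thesis
    by blast
qed

subsection \<open>Cube representations\<close>

lemma cube_representation_if_separating:
  assumes "\<And>i. i < k \<Longrightarrow> separating_unit_interval_map G (S i) (\<lambda>v. f v i)"
    and "verts G \<subseteq> (\<Union>i<k. S i)"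
  shows "cube_representation G k f"
  unfolding cube_representation_def unit_cube_Int_nonempty_iff
proof (intro ballI impI iffI allI)
  fix u v i assume "u \<rightarrow>\<^bsub>G\<^esub> v" "i < k"
  then show "\<bar>f u i - f v i\<bar> \<le> 1"
    using assms(1) by (simp add: separating_unit_interval_map_def)
next
  fix u v assume uv: "u \<in> verts G" "v \<in> verts G" "u \<noteq> v" and close: "\<forall>i<k. \<bar>f u i - f v i\<bar> \<le> 1"
  obtain i where i: "i < k" "u \<in> S i"
    using assms(2) uv(1) by blast
  then have "\<not> \<bar>f u i - f v i\<bar> > 1"
    using close by (simp add: not_less)
  then show "u \<rightarrow>\<^bsub>G\<^esub> v"
    using assms(1)[OF i(1)] i(2) uv by (auto simp: separating_unit_interval_map_def)
qed

lemma independent_set_colour_class: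
  assumes "proper_colouring G k c"
  shows "independent_set G {v \<in> verts G. c v = i}"
  using assms by (fastforce simp: independent_set_def proper_colouring_def)

theorem theorem6:
  fixes G :: "('a, 'b) pre_digraph"
  assumes "graph G" and "claw_free G" and "AT_free G"
  shows "cubicity G \<le> chromatic_number G"
proof -
  interpret graph G by (rule assms(1))
  let ?k = "chromatic_number G"
  have "\<exists>c. proper_colouring G ?k c"
    unfolding chromatic_number_def using proper_colouring_exists by (rule LeastI_ex)
  then obtain c where c: "proper_colouring G ?k c" ..
  obtain f where "separating_unit_interval_map G {v \<in> verts G. c v = i} (f i)" for i
    using separating_unit_interval_map_exists[OF assms(2,3) independent_set_colour_class[OF c]] by metis
  moreover have "verts G \<subseteq> (\<Union>i<?k. {v \<in> verts G. c v = i})"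
    using c by (auto simp: proper_colouring_def)
  ultimately have "cube_representation G ?k (\<lambda>v i. f i v)"
    by (rule cube_representation_if_separating)
  then show ?thesis
    unfolding cubicity_def by (blast intro: Least_le)
qed

end
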